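(* Let $X\subseteq\mathbb{R}$. If $X$ is a $\lambda$-set, then $(X[\leq])^2$ is pseudo-normal.
   Context: For $X\subseteq\mathbb{R}$, $X[\leq]$ denotes $X$ with the subspace topology inherited from the Sorgenfrey line, i.e. from $\mathbb{R}$ with the topology generated by the half-open intervals $[a,b)$; $(X[\leq])^2$ is the product space $X[\leq]\times X[\leq]$. A set $X\subseteq\mathbb{R}$ is a $\lambda$-set if every countable subset of $X$ is a relative $G_\delta$ in the Euclidean subspace topology of $X$. A topological space is pseudo-normal if every pair of disjoint closed sets, at least one of which is countable, can be separated by disjoint open sets. *)

theory Defs
  imports "HOL-Analysis.Analysis"
begin

definition sorgenfrey_line :: "real topology"
  where "sorgenfrey_line = topology_generated_by {{a..<b} | a b. a < b}"

definition lambda_set :: "real set \<Rightarrow> bool"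
  where "lambda_set X \<longleftrightarrow> (\<forall>C. C \<subseteq> X \<and> countable C \<longrightarrow> gdelta_in (top_of_set X) C)"

text \<open>Following the library's \<^const>\<open>normal_space\<close>, no separation axiom is built in.\<close>

definition pseudonormal_space :: "'a topology \<Rightarrow> bool"
  where "pseudonormal_space Y \<longleftrightarrow>
    (\<forall>S T. closedin Y S \<and> closedin Y T \<and> disjnt S T \<and> (countable S \<or> countable T)
       \<longrightarrow> (\<exists>U V. openin Y U \<and> openin Y V \<and> S \<subseteq> U \<and> T \<subseteq> V \<and> disjnt U V))"

end

theory Submission
  imports Defs
begin

text \<open>A \<open>\<lambda>\<close>-set \<open>X\<close> with a countable subset \<open>A\<close> carries a rank function \<open>r\<close> into the naturals that tends
  to infinity at every point of \<open>A\<close>. Let \<open>S\<close> be countable and closed, disjoint from the closed set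
  \<open>T\<close>, and let \<open>A\<close> contain both projections of \<open>S\<close>. Around the \<open>n\<close>-th point \<open>(a, b)\<close> of \<open>S\<close> take a
  half-open square missing \<open>T\<close>, so small that the ranks on \<open>(a, a + e)\<close> and \<open>(b, b + e)\<close> exceed \<open>n\<close>.
  The union \<open>V\<close> of these squares is open. It is also closed: if \<open>(x, y)\<close> lies outside \<open>V\<close>, then for
  all but finitely many squares neither \<open>a < x < a + e\<close> nor \<open>b < y < b + e\<close>, so such a square can
  meet a quadrant neighbourhood of \<open>(x, y)\<close> only if its corner \<open>(a, b)\<close>, a point of \<open>S\<close>, lies in that
  neighbourhood.\<close>

section \<open>Local bases of the Sorgenfrey line and its square\<close>

text \<open>The left end of a basic interval can be moved right to any of its points, so intervals
  starting at a point form a local base there.\<close>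

lemma openin_sorgenfrey_line:
  "openin sorgenfrey_line U \<longleftrightarrow> (\<forall>x\<in>U. \<exists>e>0. {x..<x + e} \<subseteq> U)" (is "_ \<longleftrightarrow> ?R U")
proof
  assume "openin sorgenfrey_line U"
  then have "generate_topology_on {{a..<b} | a b :: real. a < b} U"
    by (simp add: sorgenfrey_line_def openin_topology_generated_by_iff)
  then show "?R U"
  proof induction
    case Empty
    then show ?case by simp
  next
    case (Int U V)
    show ?case
    proof
      fix x assume "x \<in> U \<inter> V"
      with Int.IH obtain d e where de: "d > 0" "e > 0" "{x..<x + d} \<subseteq> U" "{x..<x + e} \<subseteq> V"
        by blast
      then have "{x..<x + min d e} \<subseteq> U \<inter> V"
        by fastforce
      with de show "\<exists>e>0. {x..<x + e} \<subseteq> U \<inter> V"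
        by (intro exI[of _ "min d e"]) auto
    qed
  next
    case (UN K)
    then show ?case by (meson Union_iff Union_upper subset_trans)
  next
    case (Basis B)
    then obtain a b where B: "B = {a..<b}" by blast
    show ?case
    proof
      fix x assume "x \<in> B"
      then show "\<exists>e>0. {x..<x + e} \<subseteq> B"
        unfolding B by (intro exI[of _ "b - x"]) auto
    qed
  qed
next
  assume R: "?R U"
  have "openin sorgenfrey_line {x..<x + e}" if "e > 0" for x e :: real
    unfolding sorgenfrey_line_def
    by (rule topology_generated_by_Basis) (use that in force)
  moreover have "\<exists>e>0. x \<in> {x..<x + e} \<and> {x..<x + e} \<subseteq> U" if "x \<in> U" for x
    using R that by force
  ultimately show "openin sorgenfrey_line U"
    unfolding openin_subopen[of _ U] by meson
qed

lemma topspace_sorgenfrey_line [simp]: "topspace sorgenfrey_line = UNIV"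
proof -
  have "openin sorgenfrey_line UNIV"
    by (auto simp: openin_sorgenfrey_line intro: exI[of _ 1])
  then show ?thesis
    using openin_subset by blast
qed

text \<open>\<open>p\<close> is the lower left corner. One side length for both coordinates gives a
  local base, since two lengths can be replaced by their minimum.\<close>

definition half_open_square :: "real \<times> real \<Rightarrow> real \<Rightarrow> (real \<times> real) set"
  where "half_open_square p e = {fst p..<fst p + e} \<times> {snd p..<snd p + e}"

lemma half_open_square_mono: "d \<le> e \<Longrightarrow> half_open_square p d \<subseteq> half_open_square p e"
  by (auto simp: half_open_square_def)

lemma openin_sorgenfrey_plane:
  "openin (prod_topology (subtopology sorgenfrey_line X) (subtopology sorgenfrey_line X)) W \<longleftrightarrow>
    W \<subseteq> X \<times> X \<and> (\<forall>p\<in>W. \<exists>e>0. half_open_square p e \<inter> X \<times> X \<subseteq> W)" (is "openin ?P W \<longleftrightarrow> ?R")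
proof
  assume W: "openin ?P W"
  show ?R
  proof (intro conjI ballI)
    show "W \<subseteq> X \<times> X"
      using openin_subset[OF W] by simp
    fix p assume "p \<in> W"
    with W have "\<exists>U' V'. openin (subtopology sorgenfrey_line X) U' \<and>
        openin (subtopology sorgenfrey_line X) V' \<and> fst p \<in> U' \<and> snd p \<in> V' \<and> U' \<times> V' \<subseteq> W"
      unfolding openin_prod_topology_alt by (metis prod.collapse)
    then obtain U V where UV: "openin sorgenfrey_line U" "openin sorgenfrey_line V"
      "fst p \<in> U" "snd p \<in> V" "(U \<inter> X) \<times> (V \<inter> X) \<subseteq> W"
      unfolding openin_subtopology by blast
    then obtain d e where de: "d > 0" "e > 0" "{fst p..<fst p + d} \<subseteq> U" "{snd p..<snd p + e} \<subseteq> V"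
      by (meson openin_sorgenfrey_line)
    have "half_open_square p (min d e) \<subseteq> U \<times> V"
      using de by (fastforce simp: half_open_square_def)
    with UV de show "\<exists>e>0. half_open_square p e \<inter> X \<times> X \<subseteq> W"
      by (intro exI[of _ "min d e"]) auto
  qed
next
  assume R: ?R
  have op: "openin (subtopology sorgenfrey_line X) ({x..<x + e} \<inter> X)" for x e
  proof -
    have "openin sorgenfrey_line {x..<x + e}"
      unfolding openin_sorgenfrey_line
    proof
      fix y assume "y \<in> {x..<x + e}"
      then show "\<exists>d>0. {y..<y + d} \<subseteq> {x..<x + e}"
        by (intro exI[of _ "x + e - y"]) auto
    qed
    then show ?thesis
      by (auto simp: openin_subtopology)
  qed
  show "openin ?P W"
    unfolding openin_prod_topology_alt
  proof (intro allI impI)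
    fix x y assume xy: "(x, y) \<in> W"
    with R obtain e where e: "e > 0" "half_open_square (x, y) e \<inter> X \<times> X \<subseteq> W"
      by blast
    show "\<exists>U V. openin (subtopology sorgenfrey_line X) U \<and> openin (subtopology sorgenfrey_line X) V \<and>
        x \<in> U \<and> y \<in> V \<and> U \<times> V \<subseteq> W"
      using op[of x e] op[of y e] e xy R
      by (intro exI[of _ "{x..<x + e} \<inter> X"] exI[of _ "{y..<y + e} \<inter> X"])
         (auto simp: half_open_square_def)
  qed
qed

lemma openin_half_open_square:
  "openin (prod_topology (subtopology sorgenfrey_line X) (subtopology sorgenfrey_line X))
     (half_open_square p e \<inter> X \<times> X)"
  unfolding openin_sorgenfrey_plane
proof (intro conjI ballI)
  fix q assume "q \<in> half_open_square p e \<inter> X \<times> X"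
  then show "\<exists>d>0. half_open_square q d \<inter> X \<times> X \<subseteq> half_open_square p e \<inter> X \<times> X"
    by (intro exI[of _ "min (fst p + e - fst q) (snd p + e - snd q)"])
       (auto simp: half_open_square_def)
qed auto

lemma closedin_half_open_square:
  "closedin (prod_topology (subtopology sorgenfrey_line X) (subtopology sorgenfrey_line X))
     (half_open_square p e \<inter> X \<times> X)"
  unfolding closedin_def openin_sorgenfrey_plane
proof (intro conjI ballI)
  fix q assume q: "q \<in> topspace (prod_topology (subtopology sorgenfrey_line X)
      (subtopology sorgenfrey_line X)) - half_open_square p e \<inter> X \<times> X"
  \<comment> \<open>A coordinate of \<open>q\<close> below that of \<open>p\<close> must not climb
    across the gap. If neither is below, one is already past the far side and only grows, so any
    positive length, here 1, will do.\<close>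
  define d where "d = min (if fst q < fst p then fst p - fst q else 1)
                          (if snd q < snd p then snd p - snd q else 1)"
  have "d > 0"
    by (simp add: d_def)
  moreover have "half_open_square q d \<inter> half_open_square p e = {}"
    using q by (auto simp: half_open_square_def d_def split: if_splits)
  ultimately show "\<exists>d>0. half_open_square q d \<inter> X \<times> X \<subseteq> topspace (prod_topology
      (subtopology sorgenfrey_line X) (subtopology sorgenfrey_line X)) - half_open_square p e \<inter> X \<times> X"
    by (intro exI[of _ d]) auto
qed auto

section \<open>Rank functions on \<lambda>-sets\<close>

text \<open>Off \<open>A\<close>, the rank is the first index in a decomposition of the relative
  F-sigma set \<open>X - A\<close> into closed pieces; finitely many pieces stay away from any point
  of \<open>A\<close>. On \<open>A\<close>, an injective enumeration takes small values only
  finitely often.\<close>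

lemma lambda_set_rank:
  assumes "lambda_set X" "A \<subseteq> X" "countable A"
  obtains r :: "real \<Rightarrow> nat" where "\<And>a. a \<in> A \<Longrightarrow> filterlim r at_top (at a within X)"
proof -
  have "fsigma_in (top_of_set X) (X - A)"
    using assms by (simp add: lambda_set_def fsigma_in_gdelta_in double_diff)
  then obtain F :: "nat \<Rightarrow> real set"
    where F: "\<And>n. closedin (top_of_set X) (F n)" "(\<Union>n. F n) = X - A"
    unfolding fsigma_in_ascending by blast
  define r where "r x = (if x \<in> A then to_nat_on A x else (LEAST n. x \<in> F n))" for x
  have "filterlim r at_top (at a within X)" if a: "a \<in> A" for a
    unfolding filterlim_at_top
  proof
    fix n :: nat
    define Z where "Z = (\<Union>k<n. F k)"
    have "closedin (top_of_set X) Z"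
      unfolding Z_def using F(1) by (intro closedin_Union) auto
    then have "openin (top_of_set X) (X - Z)"
      by (metis openin_diff openin_subtopology_self)
    then obtain U where U: "open U" "X - Z = X \<inter> U"
      by (auto simp: openin_open)
    moreover have "a \<in> X - Z"
      using a F(2) assms(2) unfolding Z_def by blast
    ultimately have 1: "eventually (\<lambda>x. x \<in> U) (at a within X)"
      by (intro topological_tendstoD[OF tendsto_ident_at]) auto
    have "finite {x \<in> A. to_nat_on A x < n}"
      by (rule finite_imageD[of "to_nat_on A"])
         (auto intro: finite_subset[of _ "{..<n}"] inj_on_subset[OF inj_on_to_nat_on[OF assms(3)]])
    \<comment> \<open>The point \<open>a\<close> may itself have small rank; it is put back so that
      the open set is a neighbourhood of \<open>a\<close>, and the punctured filter ignores its
      rank.\<close>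
    then have "open (- ({x \<in> A. to_nat_on A x < n} - {a}))"
      by (intro open_Compl finite_imp_closed) auto
    then have 2: "eventually (\<lambda>x. x \<in> - ({x \<in> A. to_nat_on A x < n} - {a})) (at a within X)"
      by (intro topological_tendstoD[OF tendsto_ident_at]) auto
    have 3: "eventually (\<lambda>x. x \<in> X \<and> x \<noteq> a) (at a within X)"
      by (auto simp: eventually_at_topological)
    from 1 2 3 show "eventually (\<lambda>x. n \<le> r x) (at a within X)"
    proof eventually_elim
      case (elim x)
      show ?case
      proof (cases "x \<in> A")
        case True
        with elim show ?thesis by (auto simp: r_def)
      next
        case False
        with F(2) elim obtain k where "x \<in> F k" by blast
        then have "x \<in> F (LEAST n. x \<in> F n)"
          by (rule LeastI)
        moreover have "x \<notin> Z"
          using elim U by blast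
        ultimately show ?thesis
          using False unfolding r_def Z_def by (auto simp: not_less[symmetric])
      qed
    qed
  qed
  then show thesis
    by (rule that)
qed

lemma filterlim_at_top_right_interval:
  fixes r :: "real \<Rightarrow> nat"
  assumes "filterlim r at_top (at a within X)"
  shows "\<exists>e>0. \<forall>x\<in>X. a < x \<and> x < a + e \<longrightarrow> n < r x"
proof -
  from assms have "eventually (\<lambda>x. Suc n \<le> r x) (at a within X)"
    by (simp add: filterlim_at_top)
  then obtain e where "e > 0" "\<forall>x\<in>X. x \<noteq> a \<and> dist x a < e \<longrightarrow> n < r x"
    unfolding eventually_at Suc_le_eq by blast
  then show ?thesis
    by (intro exI[of _ e]) (auto simp: dist_real_def)
qed

section \<open>Clopen neighbourhoods of countable closed sets\<close>

lemma countable_closed_sorgenfrey_plane_clopen: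
  fixes X :: "real set"
  defines "P \<equiv> prod_topology (subtopology sorgenfrey_line X) (subtopology sorgenfrey_line X)"
  assumes X: "lambda_set X" and S: "closedin P S" "countable S" and T: "closedin P T" and "disjnt S T"
  obtains V where "openin P V" "closedin P V" "S \<subseteq> V" "disjnt V T"
proof -
  have topP: "topspace P = X \<times> X"
    by (simp add: P_def)
  have SX: "S \<subseteq> X \<times> X"
    using S(1) topP closedin_subset by metis
  obtain r :: "real \<Rightarrow> nat"
    where r: "\<And>a. a \<in> fst ` S \<union> snd ` S \<Longrightarrow> filterlim r at_top (at a within X)"
  proof (rule lambda_set_rank[OF X])
    show "fst ` S \<union> snd ` S \<subseteq> X"
      using SX by auto
  qed (use S(2) in auto)
  define rank_above where "rank_above a e n \<longleftrightarrow> (\<forall>x\<in>X. a < x \<and> x < a + e \<longrightarrow> n < r x)" for a e n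
  have "\<exists>e>0. half_open_square c e \<inter> X \<times> X \<inter> T = {} \<and>
      rank_above (fst c) e (to_nat_on S c) \<and> rank_above (snd c) e (to_nat_on S c)" if "c \<in> S" for c
  proof -
    let ?n = "to_nat_on S c"
    have mem: "fst c \<in> fst ` S \<union> snd ` S" "snd c \<in> fst ` S \<union> snd ` S"
      using that by auto
    obtain d1 where d1: "d1 > 0" "rank_above (fst c) d1 ?n"
      using filterlim_at_top_right_interval[OF r[OF mem(1)], of ?n]
      unfolding rank_above_def by blast
    obtain d2 where d2: "d2 > 0" "rank_above (snd c) d2 ?n"
      using filterlim_at_top_right_interval[OF r[OF mem(2)], of ?n]
      unfolding rank_above_def by blast
    have "openin P (X \<times> X - T)"
      using T topP by (metis closedin_def)
    moreover have "c \<in> X \<times> X - T"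
      using that SX \<open>disjnt S T\<close> by (auto simp: disjnt_iff)
    ultimately obtain d3 where d3: "d3 > 0" "half_open_square c d3 \<inter> X \<times> X \<subseteq> X \<times> X - T"
      unfolding P_def openin_sorgenfrey_plane by blast
    define e where "e = min d1 (min d2 d3)"
    have "half_open_square c e \<subseteq> half_open_square c d3"
      by (rule half_open_square_mono) (simp add: e_def)
    with d1 d2 d3 show ?thesis
      by (intro exI[of _ e]) (auto simp: e_def rank_above_def)
  qed
  then obtain e where e: "\<And>c. c \<in> S \<Longrightarrow> e c > 0"
      "\<And>c. c \<in> S \<Longrightarrow> half_open_square c (e c) \<inter> X \<times> X \<inter> T = {}"
      "\<And>c. c \<in> S \<Longrightarrow> rank_above (fst c) (e c) (to_nat_on S c)"
      "\<And>c. c \<in> S \<Longrightarrow> rank_above (snd c) (e c) (to_nat_on S c)"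
    by metis
  define B where "B c = half_open_square c (e c) \<inter> X \<times> X" for c
  define V where "V = (\<Union>c\<in>S. B c)"
  have "openin P V"
    unfolding V_def B_def P_def using openin_half_open_square by blast
  moreover have SV: "S \<subseteq> V"
    using e(1) SX by (force simp: V_def B_def half_open_square_def)
  moreover have "disjnt V T"
    using e(2) by (auto simp: V_def B_def disjnt_iff)
  moreover have "openin P (X \<times> X - V)"
    unfolding P_def openin_sorgenfrey_plane
  proof (intro conjI ballI)
    fix p assume p: "p \<in> X \<times> X - V"
    \<comment> \<open>By the strict rank bounds, only squares with corner in \<open>J\<close> can
      have a coordinate of \<open>p\<close> in the open interior of the corresponding side.\<close>
    define J where "J = {c \<in> S. to_nat_on S c < max (r (fst p)) (r (snd p))}"
    have "finite J"
      unfolding J_def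
      by (rule finite_imageD[of "to_nat_on S"])
         (auto intro: finite_subset[of _ "{..<max (r (fst p)) (r (snd p))}"]
            inj_on_subset[OF inj_on_to_nat_on[OF S(2)]])
    \<comment> \<open>Removing the finitely many squares from \<open>J\<close> handles those
      corners; removing \<open>S\<close> as well keeps every other corner out of the neighbourhood
      of \<open>p\<close>.\<close>
    then have "closedin P (S \<union> (\<Union>c\<in>J. B c))"
      using S(1) closedin_half_open_square
      by (intro closedin_Un closedin_Union) (auto simp: B_def P_def)
    then have "openin P (X \<times> X - (S \<union> (\<Union>c\<in>J. B c)))"
      using topP by (metis closedin_def)
    moreover have "p \<in> X \<times> X - (S \<union> (\<Union>c\<in>J. B c))"
      using p SV by (auto simp: V_def J_def)
    ultimately obtain d
      where d: "d > 0" "half_open_square p d \<inter> X \<times> X \<subseteq> X \<times> X - (S \<union> (\<Union>c\<in>J. B c))"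
      unfolding P_def openin_sorgenfrey_plane by meson
    have "v \<notin> B c" if c: "c \<in> S" and v: "v \<in> half_open_square p d \<inter> X \<times> X" for c v
    proof
      assume vB: "v \<in> B c"
      then have "c \<notin> J"
        using d v by blast
      with c have "r (fst p) \<le> to_nat_on S c" "r (snd p) \<le> to_nat_on S c"
        by (auto simp: J_def)
      then have "\<not> (fst c < fst p \<and> fst p < fst c + e c)" "\<not> (snd c < snd p \<and> snd p < snd c + e c)"
        using e(3,4)[OF c] p by (auto simp: rank_above_def)
      \<comment> \<open>In each coordinate \<open>v\<close> lies in both intervals, so
        \<open>p\<close> is below the far end of the side at \<open>c\<close>. As \<open>p\<close>
        is not strictly inside that side, it is at or below \<open>c\<close>, and \<open>c\<close>
        is at or below \<open>v\<close>, hence within \<open>d\<close> of \<open>p\<close>.\<close>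
      with v vB have "c \<in> half_open_square p d"
        by (cases c; cases p) (auto simp: half_open_square_def B_def)
      with c SX d show False
        by blast
    qed
    with d show "\<exists>d>0. half_open_square p d \<inter> X \<times> X \<subseteq> X \<times> X - V"
      by (intro exI[of _ d]) (auto simp: V_def)
  qed auto
  ultimately show thesis
    using that[of V] topP openin_subset[of P V] by (simp add: closedin_def)
qed

theorem theorem3p1:
  fixes X :: "real set"
  assumes "lambda_set X"
  shows "pseudonormal_space
           (prod_topology (subtopology sorgenfrey_line X) (subtopology sorgenfrey_line X))"
  unfolding pseudonormal_space_def
proof (intro allI impI, elim conjE)
  let ?P = "prod_topology (subtopology sorgenfrey_line X) (subtopology sorgenfrey_line X)"
  \<comment> \<open>A clopen set around the countable side and its complement separate the two; if
    \<open>T\<close> is the countable one, the roles are exchanged.\<close>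
  have sep: "\<exists>U V. openin ?P U \<and> openin ?P V \<and> S \<subseteq> U \<and> T \<subseteq> V \<and> disjnt U V"
    if ST: "closedin ?P S" "closedin ?P T" "disjnt S T" "countable S" for S T
  proof -
    obtain V where V: "openin ?P V" "closedin ?P V" "S \<subseteq> V" "disjnt V T"
      using countable_closed_sorgenfrey_plane_clopen[OF assms] ST by metis
    have "openin ?P (topspace ?P - V)"
      using V(2) by (metis closedin_def)
    moreover have "T \<subseteq> topspace ?P - V"
      using V(4) closedin_subset[OF ST(2)] by (auto simp: disjnt_iff)
    ultimately show ?thesis
      using V by (intro exI[of _ V] exI[of _ "topspace ?P - V"]) (auto simp: disjnt_iff)
  qed
  fix S T
  assume ST: "closedin ?P S" "closedin ?P T" "disjnt S T" "countable S \<or> countable T"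
  then show "\<exists>U V. openin ?P U \<and> openin ?P V \<and> S \<subseteq> U \<and> T \<subseteq> V \<and> disjnt U V"
    using sep[of S T] sep[of T S] by (metis disjnt_sym)
qed

end
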